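(* Let $n$ be a positive integer and let $A, B \in M_n(\bar{\mathbb{R}})$. Then the following three conditions are equivalent: (i) $A \leq_{\mathcal{R}} B$; (ii) $C(A) \subseteq C(B)$ in affine tropical $n$-space; (iii) $PC(A) \subseteq PC(B)$ in projective tropical $(n-1)$-space. Similarly, the following three conditions are equivalent: (i') $A \leq_{\mathcal{L}} B$; (ii') $R(A) \subseteq R(B)$ in affine tropical $n$-space; (iii') $PR(A) \subseteq PR(B)$ in projective tropical $(n-1)$-space.
   Context: $\bar{\mathbb{R}} = \mathbb{R} \cup \{-\infty\}$ is the tropical semiring with $a \otimes b = a+b$ (with $-\infty$ absorbing) and $a \oplus b = \max\{a,b\}$. $M_n(\bar{\mathbb{R}})$ is the monoid of $n \times n$ matrices over $\bar{\mathbb{R}}$ under tropical matrix multiplication $(AB)_{ij} = \max_{1\le k\le n} (A_{ik} + B_{kj})$. In a monoid $S$: $A \leq_{\mathcal{R}} B$ means $AS \subseteq BS$ (equivalently $A = BX$ for some $X \in S$), and $A \leq_{\mathcal{L}} B$ means $SA \subseteq SB$. Affine tropical $n$-space is $\bar{\mathbb{R}}^n$, with vector addition the componentwise maximum and scaling by $\lambda \in \bar{\mathbb{R}}$ adding $\lambda$ to every component. Projective tropical $(n-1)$-space is obtained from $\bar{\mathbb{R}}^n$ by discarding the zero vector $(-\infty,\ldots,-\infty)$ and identifying two non-zero vectors if one is a tropical multiple of the other. The column space $C(A)$ (respectively row space $R(A)$) is the set of all tropical linear combinations of the columns (respectively rows) of $A$. $PC(A)$ and $PR(A)$ are the projectivisations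 of $C(A)$ and $R(A)$, i.e. the sets of classes in projective tropical $(n-1)$-space of the non-zero vectors of $C(A)$ and $R(A)$. *)

theory Defs
  imports "HOL-Analysis.Analysis"
begin

text \<open>
  Tropical addition \<open>\<oplus>\<close> (maximum) and tropical multiplication \<open>\<otimes>\<close> (real addition, with
  \<open>-\<infinity>\<close> absorbing) are the class operations \<open>+\<close> and \<open>*\<close>. Hence on type \<open>trop\<close> the
  constant \<open>0\<close> is \<open>-\<infinity>\<close> and \<open>1\<close> is the real number zero, and the library operations
  \<open>\<Sum>\<close>, \<open>*s\<close> and \<open>**\<close> are the tropical ones.
\<close>

datatype trop = NegInf | Fin real

instantiation trop :: linorder
begin

fun less_eq_trop :: "trop \<Rightarrow> trop \<Rightarrow> bool" where
  "NegInf \<le> b \<longleftrightarrow> True"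
| "Fin x \<le> NegInf \<longleftrightarrow> False"
| "Fin x \<le> Fin y \<longleftrightarrow> x \<le> y"

definition less_trop :: "trop \<Rightarrow> trop \<Rightarrow> bool" where
  "a < b \<longleftrightarrow> a \<le> b \<and> \<not> b \<le> (a::trop)"

instance
proof
  fix a b c :: trop
  show "a < b \<longleftrightarrow> a \<le> b \<and> \<not> b \<le> a" by (rule less_trop_def)
  show "a \<le> a" by (cases a) auto
  show "a \<le> b \<Longrightarrow> b \<le> c \<Longrightarrow> a \<le> c" by (cases a; cases b; cases c) auto
  show "a \<le> b \<Longrightarrow> b \<le> a \<Longrightarrow> a = b" by (cases a; cases b) auto
  show "a \<le> b \<or> b \<le> a" by (cases a; cases b) auto
qed

end

instantiation trop :: comm_semiring_1
begin

definition zero_trop :: trop where "0 = NegInf"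

definition one_trop :: trop where "1 = Fin 0"

definition plus_trop :: "trop \<Rightarrow> trop \<Rightarrow> trop" where "a + b = max a (b::trop)"

fun times_trop :: "trop \<Rightarrow> trop \<Rightarrow> trop" where
  "NegInf * b = NegInf"
| "Fin x * NegInf = NegInf"
| "Fin x * Fin y = Fin (x + y)"

instance
proof
  fix a b c :: trop
  show "a * b * c = a * (b * c)" by (cases a; cases b; cases c) auto
  show "a * b = b * a" by (cases a; cases b) auto
  show "1 * a = a" by (cases a) (auto simp: one_trop_def)
  show "a + b + c = a + (b + c)" by (simp add: plus_trop_def max.assoc)
  show "a + b = b + a" by (simp add: plus_trop_def max.commute)
  show "0 + a = a" by (simp add: plus_trop_def zero_trop_def max_def)
  show "(a + b) * c = a * c + b * c"
    by (cases a; cases b; cases c) (auto simp: plus_trop_def max_def)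
  show "0 * a = 0" by (simp add: zero_trop_def)
  show "a * 0 = 0" by (cases a) (simp_all add: zero_trop_def)
  show "(0::trop) \<noteq> 1" by (simp add: zero_trop_def one_trop_def)
qed

end

text \<open>
  Green's preorders, for the monoid whose underlying set is a whole type and whose product is
  \<open>f\<close>. The product is a parameter because \<open>*\<close> on square matrices is the entrywise product;
  the matrix monoid has product \<open>**\<close>.
\<close>

definition green_le_R :: "('a \<Rightarrow> 'a \<Rightarrow> 'a) \<Rightarrow> 'a \<Rightarrow> 'a \<Rightarrow> bool" where
  "green_le_R f a b \<longleftrightarrow> {f a x |x. True} \<subseteq> {f b x |x. True}"

definition green_le_L :: "('a \<Rightarrow> 'a \<Rightarrow> 'a) \<Rightarrow> 'a \<Rightarrow> 'a \<Rightarrow> bool" where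
  "green_le_L f a b \<longleftrightarrow> {f x a |x. True} \<subseteq> {f x b |x. True}"

lemma monoid_trop_matrix: "monoid ((**) :: trop^'n^'n \<Rightarrow> _) (mat 1)"
  by standard (simp_all only: matrix_mul_assoc matrix_mul_lid matrix_mul_rid)

definition column_space :: "trop^'n^'n \<Rightarrow> (trop^'n) set" where
  "column_space A = {(\<Sum>j\<in>UNIV. c j *s column j A) |c. True}"

definition row_space :: "trop^'n^'n \<Rightarrow> (trop^'n) set" where
  "row_space A = {(\<Sum>i\<in>UNIV. c i *s row i A) |c. True}"

definition proj_rel :: "((trop^'n) \<times> (trop^'n)) set" where
  "proj_rel = {(x, y). x \<noteq> 0 \<and> y \<noteq> 0 \<and> ((\<exists>l. y = l *s x) \<or> (\<exists>l. x = l *s y))}"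

definition proj_space :: "(trop^'n) set set" where
  "proj_space = (UNIV - {0}) // proj_rel"

definition projectivisation :: "(trop^'n) set \<Rightarrow> (trop^'n) set set" where
  "projectivisation V = (V - {0}) // proj_rel"

lemma scale_swap:
  fixes x y :: "trop^'n"
  assumes "y = l *s x" "y \<noteq> 0"
  shows "\<exists>m. x = m *s y"
proof (cases l)
  case NegInf
  then have "y = 0" using assms(1) by (simp add: vec_eq_iff zero_trop_def)
  then show ?thesis using assms(2) by simp
next
  case (Fin r)
  have inv: "Fin (- r) * Fin r = 1" by (simp add: one_trop_def)
  have "x = Fin (- r) *s y"
    unfolding assms(1) Fin
    by (simp add: vec_eq_iff mult.assoc[symmetric] inv del: times_trop.simps)
  then show ?thesis by blast
qed

lemma proj_rel_iff:
  "(x, y) \<in> proj_rel \<longleftrightarrow> x \<noteq> 0 \<and> y \<noteq> 0 \<and> (\<exists>l. y = l *s x)"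
proof
  assume *: "(x, y) \<in> proj_rel"
  then have nz: "x \<noteq> 0" "y \<noteq> 0" by (simp_all add: proj_rel_def)
  from * consider l where "y = l *s x" | l where "x = l *s y"
    by (auto simp: proj_rel_def)
  then show "x \<noteq> 0 \<and> y \<noteq> 0 \<and> (\<exists>l. y = l *s x)"
  proof cases
    case 1
    with nz show ?thesis by blast
  next
    case 2
    from scale_swap[OF 2 nz(1)] nz show ?thesis by blast
  qed
next
  assume "x \<noteq> 0 \<and> y \<noteq> 0 \<and> (\<exists>l. y = l *s x)"
  then show "(x, y) \<in> proj_rel" by (simp add: proj_rel_def)
qed

lemma equiv_proj_rel: "equiv (UNIV - {0}) (proj_rel :: ((trop^'n) \<times> (trop^'n)) set)"
proof (rule equivI)
  show "proj_rel \<subseteq> (UNIV - {0 :: trop^'n}) \<times> (UNIV - {0})"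
    by (auto simp: proj_rel_def)
  show "refl_on (UNIV - {0 :: trop^'n}) proj_rel"
  proof (rule refl_onI)
    fix x :: "trop^'n"
    assume "x \<in> UNIV - {0}"
    moreover have "x = 1 *s x" by (simp add: vec_eq_iff)
    ultimately show "(x, x) \<in> proj_rel" unfolding proj_rel_iff by blast
  qed
  show "sym (proj_rel :: ((trop^'n) \<times> (trop^'n)) set)"
    by (auto simp: sym_def proj_rel_def)
  show "trans (proj_rel :: ((trop^'n) \<times> (trop^'n)) set)"
  proof (rule transI)
    fix x y z :: "trop^'n"
    assume "(x, y) \<in> proj_rel" "(y, z) \<in> proj_rel"
    then obtain k l where "y = l *s x" "z = k *s y" and nz: "x \<noteq> 0" "z \<noteq> 0"
      by (auto simp only: proj_rel_iff)
    then have "z = (k * l) *s x" by (simp add: vec_eq_iff mult.assoc)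
    with nz show "(x, z) \<in> proj_rel" unfolding proj_rel_iff by blast
  qed
qed

lemma projectivisation_subset_proj_space: "projectivisation V \<subseteq> proj_space"
  by (auto simp: projectivisation_def proj_space_def quotient_def)

end

theory Submission imports Defs
begin

text \<open>
  The column space of \<open>A\<close> is the image of the linear map \<open>v \<mapsto> A v\<close>. Hence \<open>A = B X\<close> gives
  \<open>A v = B (X v)\<close> and an inclusion of column spaces. Conversely, such an inclusion solves
  \<open>B x = (column j of A)\<close> for every \<open>j\<close>, and the solutions, taken as columns, form an \<open>X\<close>
  with \<open>A = B X\<close>; this is \<open>green_le_R_iff_column_space\<close>.

  Projectivising loses nothing (\<open>subset_iff_projectivisation_subset\<close>): a column space contains
  the zero vector and is closed under scaling, so it is determined by the classes of its
  non-zero vectors.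

  The statements about rows are those about columns for the transposed matrices, since
  transposition reverses products and thereby exchanges \<open>\<L>\<close> with \<open>\<R>\<close>.
\<close>

lemma column_space_eq_range: "column_space A = range ((*v) A)"
proof -
  have "(\<Sum>j\<in>UNIV. c j *s column j A) = A *v vec_lambda c" for c
    by (simp add: matrix_mult_sum)
  then have "(\<Sum>j\<in>UNIV. c j *s column j A) \<in> range ((*v) A)" for c
    by simp
  then show ?thesis
    by (auto simp: column_space_def matrix_mult_sum)
qed

lemma row_space_eq_column_space_transpose: "row_space A = column_space (transpose A)"
  by (simp add: row_space_def column_space_def)

lemma green_le_R_matrix_iff:
  fixes A B :: "trop^'n^'n"
  shows "green_le_R (**) A B \<longleftrightarrow> (\<exists>X. A = B ** X)"
proof
  assume "green_le_R (**) A B"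
  moreover have "A \<in> {A ** X |X. True}"
    using matrix_mul_rid[of A] by (metis (mono_tags, lifting) mem_Collect_eq)
  ultimately show "\<exists>X. A = B ** X"
    unfolding green_le_R_def by blast
next
  assume "\<exists>X. A = B ** X"
  then obtain X where "A = B ** X" ..
  then have "A ** Y = B ** (X ** Y)" for Y
    by (simp add: matrix_mul_assoc)
  then show "green_le_R (**) A B"
    unfolding green_le_R_def by blast
qed

lemma green_le_L_iff_transpose:
  fixes A B :: "trop^'n^'n"
  shows "green_le_L (**) A B \<longleftrightarrow> green_le_R (**) (transpose A) (transpose B)"
proof -
  have products: "{transpose M ** X |X. True} = transpose ` {X ** M |X. True}"
    for M :: "trop^'n^'n"
  proof -
    have "transpose M ** X = transpose (transpose X ** M)" for X
      by (simp add: matrix_transpose_mul)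
    then have "transpose M ** X \<in> transpose ` {X ** M |X. True}" for X
      by (metis (mono_tags, lifting) imageI mem_Collect_eq)
    then show ?thesis
      by (auto simp: matrix_transpose_mul)
  qed
  have "inj (transpose :: trop^'n^'n \<Rightarrow> _)"
    by (metis injI transpose_transpose)
  then show ?thesis
    unfolding green_le_L_def green_le_R_def products by (simp add: inj_image_subset_iff)
qed

lemma green_le_R_iff_column_space:
  fixes A B :: "trop^'n^'n"
  shows "green_le_R (**) A B \<longleftrightarrow> column_space A \<subseteq> column_space B"
proof
  assume "green_le_R (**) A B"
  then obtain X where "A = B ** X"
    unfolding green_le_R_matrix_iff ..
  then have "A *v v = B *v (X *v v)" for v
    by (simp add: matrix_vector_mul_assoc)
  then show "column_space A \<subseteq> column_space B"
    unfolding column_space_eq_range by auto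
next
  assume sub: "column_space A \<subseteq> column_space B"
  have "\<exists>x. B *v x = column j A" for j
  proof -
    have "A *v axis j 1 \<in> column_space B"
      using sub unfolding column_space_eq_range by blast
    moreover have "A *v axis j 1 = column j A"
      by (simp add: vec_eq_iff matrix_vector_mult_def axis_def column_def if_distrib
          cong: if_cong)
    ultimately show ?thesis
      unfolding column_space_eq_range by auto
  qed
  then obtain x where x: "\<And>j. B *v x j = column j A"
    by metis
  have "A = B ** (\<chi> k j. x j $ k)"
    using x by (simp add: vec_eq_iff matrix_matrix_mult_def matrix_vector_mult_def column_def)
  then show "green_le_R (**) A B"
    unfolding green_le_R_matrix_iff by blast
qed

text \<open>
  If a non-zero \<open>v \<in> V\<close> has its class among those of \<open>W\<close>, then \<open>v\<close> is a multiple of some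
  \<open>w \<in> W\<close>, and closure under scaling puts \<open>v\<close> itself into \<open>W\<close>. The zero vector is invisible
  projectively, which is why \<open>0 \<in> W\<close> has to be assumed.
\<close>

lemma subset_iff_projectivisation_subset:
  fixes V W :: "(trop^'n) set"
  assumes zero: "0 \<in> W" and scale: "\<And>l w. w \<in> W \<Longrightarrow> l *s w \<in> W"
  shows "V \<subseteq> W \<longleftrightarrow> projectivisation V \<subseteq> projectivisation W"
proof
  assume "V \<subseteq> W"
  then show "projectivisation V \<subseteq> projectivisation W"
    by (auto simp: projectivisation_def quotient_def)
next
  assume sub: "projectivisation V \<subseteq> projectivisation W"
  show "V \<subseteq> W"
  proof
    fix v assume "v \<in> V"
    show "v \<in> W"
    proof (cases "v = 0")
      case True
      with zero show ?thesis by simp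
    next
      case False
      with \<open>v \<in> V\<close> have "proj_rel `` {v} \<in> projectivisation V"
        by (simp add: projectivisation_def quotientI)
      with sub obtain w where "w \<in> W" and "proj_rel `` {v} = proj_rel `` {w}"
        unfolding projectivisation_def by (metis DiffD1 quotientE subsetD)
      moreover have "v \<in> proj_rel `` {v}"
        using equiv_class_self[OF equiv_proj_rel] False by blast
      ultimately have "(w, v) \<in> proj_rel"
        by blast
      then obtain l where "v = l *s w"
        unfolding proj_rel_iff by blast
      with scale \<open>w \<in> W\<close> show ?thesis by simp
    qed
  qed
qed

lemma column_space_subset_iff_projectivisation:
  "column_space A \<subseteq> column_space B \<longleftrightarrow>
     projectivisation (column_space A) \<subseteq> projectivisation (column_space B)"
proof (rule subset_iff_projectivisation_subset)
  have "0 = B *v 0"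
    by (simp add: vec_eq_iff matrix_vector_mult_def)
  then show "0 \<in> column_space B"
    unfolding column_space_eq_range by (rule range_eqI)
next
  fix l w assume "w \<in> column_space B"
  then obtain v where "w = B *v v"
    unfolding column_space_eq_range by blast
  then have "l *s w = B *v (l *s v)"
    by (simp add: vec_eq_iff matrix_vector_mult_def sum_distrib_left mult.left_commute)
  then show "l *s w \<in> column_space B"
    unfolding column_space_eq_range by blast
qed

theorem lemma3p1:
  fixes A B :: "trop^'n^'n"
  shows "((green_le_R (**) A B \<longleftrightarrow> column_space A \<subseteq> column_space B)
        \<and> (column_space A \<subseteq> column_space B \<longleftrightarrow>
             projectivisation (column_space A) \<subseteq> projectivisation (column_space B)))
      \<and> ((green_le_L (**) A B \<longleftrightarrow> row_space A \<subseteq> row_space B)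
        \<and> (row_space A \<subseteq> row_space B \<longleftrightarrow>
             projectivisation (row_space A) \<subseteq> projectivisation (row_space B)))"
  unfolding row_space_eq_column_space_transpose green_le_L_iff_transpose
  by (intro conjI green_le_R_iff_column_space column_space_subset_iff_projectivisation)

end
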